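(* Let $\mathcal{R}$ be a partial applicative structure such that $\Sigma[\mathcal{R}]$ is posetal, and let $r\in\mathcal{R}$. Then for every $s\in\mathcal{R}$, either $r\cdot s=s$, or there exists a natural number $n$ such that $[r]^n(s)$ is undefined and $[r]^i(s)\neq[r]^j(s)$ for every $i,j<n$ such that $i\neq j$.
   Context: A partial applicative structure is a non-empty set $\mathcal{R}$ together with a partial binary function $\cdot:\mathcal{R}\times\mathcal{R}\rightharpoonup\mathcal{R}$; $t\downarrow$ means that $t$ is defined. For $r\in\mathcal{R}$, $[r]$ denotes the partial function from $\mathcal{R}$ to $\mathcal{R}$ with domain $\{x\in\mathcal{R}\mid r\cdot x\downarrow\}$ and $[r](x)=r\cdot x$; $[r]^n$ is its $n$-fold iterate as a partial function, with $[r]^0$ the identity. A PR-structure is a triple $\Sigma=(\mathsf{P}_\Sigma,\mathsf{R}_\Sigma,\rho^\Sigma)$ where $\mathsf{P}_\Sigma$ and $\mathsf{R}_\Sigma$ are non-empty sets and $\rho^\Sigma:\mathsf{P}_\Sigma\times\mathsf{P}_\Sigma\to\mathcal{P}(\mathsf{R}_\Sigma)$ is a function. For a set $I$ and functions $\varphi,\psi:I\to\mathsf{P}_\Sigma$, write $\varphi\vdash^\Sigma_I\psi$ iff $\bigcap_{i\in I}\rho^\Sigma(\varphi(i),\psi(i))\neq\emptyset$, i.e. iff there is $r\in\mathsf{R}_\Sigma$ with $r\in\rho^\Sigma(\varphi(i),\psi(i))$ for every $i\in I$. $\Sigma$ is posetal if for every set $I$ the relation $\vdash^\Sigma_I$ on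 $\mathsf{P}_\Sigma^I$ is a partial order. The PR-structure associated to $\mathcal{R}$ is $\Sigma[\mathcal{R}]:=(\mathcal{P}(\mathcal{R}),\mathcal{R},\Rightarrow)$ where, for $A,B\subseteq\mathcal{R}$, $A\Rightarrow B:=\{r\in\mathcal{R}\mid \text{for every } a\in A,\ r\cdot a\downarrow \text{ and } r\cdot a\in B\}$. *)

theory Defs
  imports Main "HOL-Library.FuncSet"
begin

text \<open>A partial binary operation is a function into an option type: \<open>app r x = None\<close> means
  that \<open>r \<cdot> x\<close> is undefined. Only the values of \<open>app\<close> on the carrier \<open>A\<close> matter.\<close>

locale partial_applicative_structure =
  fixes A :: "'a set" and app :: "'a \<Rightarrow> 'a \<Rightarrow> 'a option"
  assumes nonempty: "A \<noteq> {}"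
    and closed: "\<lbrakk>r \<in> A; x \<in> A; app r x = Some y\<rbrakk> \<Longrightarrow> y \<in> A"

definition app_fun :: "'a set \<Rightarrow> ('a \<Rightarrow> 'a \<Rightarrow> 'a option) \<Rightarrow> 'a \<Rightarrow> ('a \<rightharpoonup> 'a)" where
  "app_fun A app r = app r |` A"

primrec app_iter :: "'a set \<Rightarrow> ('a \<Rightarrow> 'a \<Rightarrow> 'a option) \<Rightarrow> 'a \<Rightarrow> nat \<Rightarrow> ('a \<rightharpoonup> 'a)" where
  "app_iter A app r 0 = Some |` A"
| "app_iter A app r (Suc n) = app_fun A app r \<circ>\<^sub>m app_iter A app r n"

record ('p, 'r) pr_struct =
  Props :: "'p set"
  Reals :: "'r set"
  rho :: "'p \<Rightarrow> 'p \<Rightarrow> 'r set"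

definition pr_structure :: "('p, 'r) pr_struct \<Rightarrow> bool" where
  "pr_structure S \<longleftrightarrow> Props S \<noteq> {} \<and> Reals S \<noteq> {} \<and>
     (\<forall>p\<in>Props S. \<forall>q\<in>Props S. rho S p q \<subseteq> Reals S)"

text \<open>Functions \<open>I \<rightarrow> Props S\<close> are represented extensionally, so that equality of
  representatives is equality of functions on \<open>I\<close>. For empty \<open>I\<close> the intersection is all of
  \<open>Reals S\<close>, whence the explicit membership in \<open>Reals S\<close>.\<close>

definition entails :: "('p, 'r) pr_struct \<Rightarrow> 'i set \<Rightarrow> (('i \<Rightarrow> 'p) \<times> ('i \<Rightarrow> 'p)) set" where
  "entails S I = {(\<phi>, \<psi>). \<phi> \<in> I \<rightarrow>\<^sub>E Props S \<and> \<psi> \<in> I \<rightarrow>\<^sub>E Props S \<and>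
     (\<exists>r\<in>Reals S. \<forall>i\<in>I. r \<in> rho S (\<phi> i) (\<psi> i))}"

text \<open>A definition in HOL cannot quantify over index sets of all types. The axioms of a partial
  order involve at most three functions \<open>\<phi>, \<psi>, \<chi> : I \<rightarrow> Props S\<close> at a time, and these factor
  through the image of \<open>I\<close> in triples of propositions; so index sets of triples already account
  for index sets of every type, as lemma \<open>posetal_all_index_types\<close> records.\<close>

definition posetal :: "('p, 'r) pr_struct \<Rightarrow> bool" where
  "posetal S \<longleftrightarrow> (\<forall>I :: ('p \<times> 'p \<times> 'p) set. partial_order_on (I \<rightarrow>\<^sub>E Props S) (entails S I))"

lemma posetal_all_index_types:
  fixes S :: "('p, 'r) pr_struct" and I :: "'i set"
  assumes pos: "posetal S"
  shows "partial_order_on (I \<rightarrow>\<^sub>E Props S) (entails S I)"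
proof -
  let ?F = "I \<rightarrow>\<^sub>E Props S"
  define k where "k \<phi> \<psi> \<chi> i = (\<phi> i, \<psi> i, \<chi> i)" for \<phi> \<psi> \<chi> :: "'i \<Rightarrow> 'p" and i
  have po: "partial_order_on (J \<rightarrow>\<^sub>E Props S) (entails S J)" for J :: "('p \<times> 'p \<times> 'p) set"
    using pos by (simp add: posetal_def)
  have tr: "(restrict f J, restrict g J) \<in> entails S J \<longleftrightarrow>
      (\<exists>r\<in>Reals S. \<forall>j\<in>J. r \<in> rho S (f j) (g j))"
    if "f \<in> J \<rightarrow> Props S" "g \<in> J \<rightarrow> Props S" for f g and J :: "('p \<times> 'p \<times> 'p) set"
    using that by (auto simp: entails_def)
  have P: "fst \<in> k \<phi> \<psi> \<chi> ` I \<rightarrow> Props S" "(\<lambda>x. fst (snd x)) \<in> k \<phi> \<psi> \<chi> ` I \<rightarrow> Props S"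
      "(\<lambda>x. snd (snd x)) \<in> k \<phi> \<psi> \<chi> ` I \<rightarrow> Props S"
    if "\<phi> \<in> ?F" "\<psi> \<in> ?F" "\<chi> \<in> ?F" for \<phi> \<psi> \<chi>
    using that by (auto simp: k_def)
  have refl: "(\<phi>, \<phi>) \<in> entails S I" if "\<phi> \<in> ?F" for \<phi>
  proof -
    let ?J = "k \<phi> \<phi> \<phi> ` I"
    have "(restrict fst ?J, restrict fst ?J) \<in> entails S ?J"
      using po[of ?J] P[OF that that that]
      by (auto simp: partial_order_on_def preorder_on_def intro!: refl_onD)
    then show ?thesis
      using that tr[OF P(1) P(1), OF that that that that that that]
      by (auto simp: entails_def k_def)
  qed
  have trans: "(\<phi>, \<chi>) \<in> entails S I"
    if "(\<phi>, \<psi>) \<in> entails S I" "(\<psi>, \<chi>) \<in> entails S I" for \<phi> \<psi> \<chi>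
  proof -
    let ?J = "k \<phi> \<psi> \<chi> ` I"
    have F: "\<phi> \<in> ?F" "\<psi> \<in> ?F" "\<chi> \<in> ?F" using that by (auto simp: entails_def)
    note Q = P[OF F]
    have "(restrict fst ?J, restrict (\<lambda>x. fst (snd x)) ?J) \<in> entails S ?J"
      unfolding tr[OF Q(1) Q(2)] using that(1) by (auto simp: entails_def k_def)
    moreover have "(restrict (\<lambda>x. fst (snd x)) ?J, restrict (\<lambda>x. snd (snd x)) ?J) \<in> entails S ?J"
      unfolding tr[OF Q(2) Q(3)] using that(2) by (auto simp: entails_def k_def)
    ultimately have "(restrict fst ?J, restrict (\<lambda>x. snd (snd x)) ?J) \<in> entails S ?J"
      using po[of ?J] by (meson partial_order_on_def preorder_on_def transD)
    then show ?thesis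
      unfolding tr[OF Q(1) Q(3)] using F by (auto simp: entails_def k_def)
  qed
  have antisym: "\<phi> = \<psi>"
    if "(\<phi>, \<psi>) \<in> entails S I" "(\<psi>, \<phi>) \<in> entails S I" for \<phi> \<psi>
  proof -
    let ?J = "k \<phi> \<psi> \<psi> ` I"
    have F: "\<phi> \<in> ?F" "\<psi> \<in> ?F" using that by (auto simp: entails_def)
    note Q = P[OF F(1) F(2) F(2)]
    have "(restrict fst ?J, restrict (\<lambda>x. fst (snd x)) ?J) \<in> entails S ?J"
      unfolding tr[OF Q(1) Q(2)] using that(1) by (auto simp: entails_def k_def)
    moreover have "(restrict (\<lambda>x. fst (snd x)) ?J, restrict fst ?J) \<in> entails S ?J"
      unfolding tr[OF Q(2) Q(1)] using that(2) by (auto simp: entails_def k_def)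
    ultimately have eq: "restrict fst ?J = restrict (\<lambda>x. fst (snd x)) ?J"
      using po[of ?J] by (meson partial_order_on_def antisymD)
    have "\<phi> i = \<psi> i" if "i \<in> I" for i
      using fun_cong[OF eq, of "k \<phi> \<psi> \<psi> i"] that by (simp add: k_def)
    then show ?thesis using F by (meson PiE_ext)
  qed
  have sub: "entails S I \<subseteq> ?F \<times> ?F"
    by (auto simp: entails_def)
  have "refl_on ?F (entails S I)" using refl sub by (auto simp: refl_on_def)
  moreover have "trans (entails S I)" using trans by (rule transI)
  moreover have "antisym (entails S I)" using antisym by (rule antisymI)
  ultimately show ?thesis
    using sub by (simp add: partial_order_on_def preorder_on_def)
qed

definition arrow :: "'a set \<Rightarrow> ('a \<Rightarrow> 'a \<Rightarrow> 'a option) \<Rightarrow> 'a set \<Rightarrow> 'a set \<Rightarrow> 'a set" where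
  "arrow A app X Y = {r \<in> A. \<forall>a\<in>X. \<exists>b. app r a = Some b \<and> b \<in> Y}"

definition assoc_pr :: "'a set \<Rightarrow> ('a \<Rightarrow> 'a \<Rightarrow> 'a option) \<Rightarrow> ('a set, 'a) pr_struct" where
  "assoc_pr A app = \<lparr>Props = Pow A, Reals = A, rho = arrow A app\<rparr>"

lemma (in partial_applicative_structure) pr_structure_assoc_pr:
  "pr_structure (assoc_pr A app)"
  using nonempty by (auto simp: pr_structure_def assoc_pr_def arrow_def)

end

theory Submission
  imports Defs
begin

text \<open>For a single index, \<open>posetal\<close> says that \<open>X \<le> Y \<longleftrightarrow> arrow A app X Y \<noteq> {}\<close> is a partial order
  on subsets of \<open>A\<close>. If all iterates \<open>s\<^sub>0 = s, s\<^sub>1, s\<^sub>2, \<dots>\<close> exist, then \<open>r\<close> realizes both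
  inequalities between \<open>{s\<^sub>0, s\<^sub>1, \<dots>}\<close> and \<open>{s\<^sub>1, s\<^sub>2, \<dots>}\<close>, so \<open>s = s\<^sub>k\<close> for some \<open>k > 0\<close>.
  Hence \<open>{s\<^sub>0} \<le> {s\<^sub>1} \<le> \<dots> \<le> {s\<^sub>k} = {s\<^sub>0}\<close>, which forces \<open>s\<^sub>1 = s\<close>.
  Otherwise let \<open>n\<close> be least with \<open>s\<^sub>n\<close> undefined; a repetition before \<open>n\<close> would make
  the iteration eventually periodic and so everywhere defined.\<close>

text \<open>A function on a one-point set is just one subset of \<open>A\<close>. As the index set
  is all of \<open>unit\<close>, extensionality imposes nothing on the constant functions.\<close>

lemma entails_assoc_pr_unit_iff:
  fixes X Y :: "'a set"
  assumes "X \<subseteq> A" "Y \<subseteq> A"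
  shows "((\<lambda>_::unit. X), (\<lambda>_. Y)) \<in> entails (assoc_pr A app) UNIV \<longleftrightarrow> arrow A app X Y \<noteq> {}"
proof -
  have "(\<exists>r\<in>A. r \<in> arrow A app X Y) \<longleftrightarrow> arrow A app X Y \<noteq> {}"
    unfolding arrow_def by blast
  then show ?thesis
    using assms by (simp add: entails_def assoc_pr_def PiE_UNIV_domain)
qed

lemma posetal_assoc_pr_arrow:
  assumes "posetal (assoc_pr A app)"
  shows arrow_refl: "X \<subseteq> A \<Longrightarrow> arrow A app X X \<noteq> {}"
    and arrow_trans: "\<lbrakk>arrow A app X Y \<noteq> {}; arrow A app Y Z \<noteq> {};
      X \<subseteq> A; Y \<subseteq> A; Z \<subseteq> A\<rbrakk> \<Longrightarrow> arrow A app X Z \<noteq> {}"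
    and arrow_antisym: "\<lbrakk>arrow A app X Y \<noteq> {}; arrow A app Y X \<noteq> {};
      X \<subseteq> A; Y \<subseteq> A\<rbrakk> \<Longrightarrow> X = Y"
proof -
  let ?E = "entails (assoc_pr A app) (UNIV :: unit set)"
  let ?F = "(UNIV :: unit set) \<rightarrow>\<^sub>E Props (assoc_pr A app)"
  have po: "refl_on ?F ?E" "trans ?E" "antisym ?E"
    using posetal_all_index_types[OF assms, of "UNIV :: unit set"]
    by (simp_all add: partial_order_on_def preorder_on_def)
  note iff = entails_assoc_pr_unit_iff[where A = A and app = app]
  show "arrow A app X X \<noteq> {}" if X: "X \<subseteq> A"
  proof -
    have "(\<lambda>_. X) \<in> ?F" using X by (simp add: assoc_pr_def PiE_UNIV_domain)
    from refl_onD[OF po(1) this] show ?thesis by (rule iff[OF X X, THEN iffD1])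
  qed
  show "arrow A app X Z \<noteq> {}" if XY: "arrow A app X Y \<noteq> {}" and YZ: "arrow A app Y Z \<noteq> {}"
      and X: "X \<subseteq> A" and Y: "Y \<subseteq> A" and Z: "Z \<subseteq> A"
    using transD[OF po(2) iff[OF X Y, THEN iffD2, OF XY] iff[OF Y Z, THEN iffD2, OF YZ]]
    by (rule iff[OF X Z, THEN iffD1])
  show "X = Y" if XY: "arrow A app X Y \<noteq> {}" and YX: "arrow A app Y X \<noteq> {}"
      and X: "X \<subseteq> A" and Y: "Y \<subseteq> A"
    using antisymD[OF po(3) iff[OF X Y, THEN iffD2, OF XY] iff[OF Y X, THEN iffD2, OF YX]]
    by (rule fun_cong)
qed

lemma posetal_total_orbit_fixed:
  fixes f :: "nat \<Rightarrow> 'a"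
  assumes pos: "posetal (assoc_pr A app)" and r: "r \<in> A"
    and f: "\<And>n. f n \<in> A" and step: "\<And>n. app r (f n) = Some (f (Suc n))"
  shows "f (Suc 0) = f 0"
proof -
  have "range f = range (f \<circ> Suc)"
  proof (rule arrow_antisym[OF pos])
    show "arrow A app (range f) (range (f \<circ> Suc)) \<noteq> {}"
      using r step by (auto simp: arrow_def)
    \<comment> \<open>\<open>r\<close> also serves here: it maps the orbit without its first point
      into itself, hence into the whole orbit.\<close>
    show "arrow A app (range (f \<circ> Suc)) (range f) \<noteq> {}"
      using r step by (auto simp: arrow_def)
  qed (use f in auto)
  then obtain k where k: "f 0 = f (Suc k)"
    by (metis comp_apply rangeE rangeI)
  have arrow_step: "arrow A app {f n} {f (Suc n)} \<noteq> {}" for n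
    using r step by (auto simp: arrow_def)
  \<comment> \<open>The chain starts at \<open>f (Suc 0)\<close>, so that for \<open>n = k\<close>
    it ends at \<open>f (Suc k) = f 0\<close> and reverses the first step.\<close>
  have "arrow A app {f (Suc 0)} {f (Suc n)} \<noteq> {}" for n
  proof (induction n)
    case 0
    show ?case using f by (intro arrow_refl[OF pos]) auto
  next
    case (Suc n)
    show ?case by (rule arrow_trans[OF pos Suc arrow_step]) (use f in auto)
  qed
  from this[of k] have "{f (Suc 0)} = {f 0}"
    using arrow_step[of 0] f k by (intro arrow_antisym[OF pos]) auto
  then show ?thesis by simp
qed

text \<open>Each iterate, undefinedness included, depends only on the value of the preceding
  one.\<close>

lemma app_iter_add_cong:
  assumes "app_iter A app r i s = app_iter A app r j s"
  shows "app_iter A app r (i + d) s = app_iter A app r (j + d) s"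
  using assms by (induction d) (simp_all add: map_comp_def)

text \<open>Shifting a repetition by \<open>n - j\<close> would carry the undefinedness at
  \<open>n\<close> back to the earlier index \<open>i + (n - j)\<close>.\<close>

lemma app_iter_inj_below_Least:
  assumes none: "app_iter A app r n s = None"
    and defined: "\<And>m. m < n \<Longrightarrow> app_iter A app r m s \<noteq> None"
    and "i < j" "j < n"
  shows "app_iter A app r i s \<noteq> app_iter A app r j s"
proof
  assume "app_iter A app r i s = app_iter A app r j s"
  from app_iter_add_cong[OF this, of "n - j"] have "app_iter A app r (i + (n - j)) s = None"
    using none \<open>j < n\<close> by simp
  moreover have "i + (n - j) < n" using \<open>i < j\<close> \<open>j < n\<close> by linarith
  ultimately show False using defined by blast
qed

theorem theorem3p4:
  fixes A :: "'a set" and app :: "'a \<Rightarrow> 'a \<Rightarrow> 'a option" and r :: 'a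
  assumes "partial_applicative_structure A app"
    and "posetal (assoc_pr A app)"
    and "r \<in> A"
  shows "\<forall>s\<in>A. app r s = Some s \<or>
    (\<exists>n. app_iter A app r n s = None \<and>
      (\<forall>i<n. \<forall>j<n. i \<noteq> j \<longrightarrow> app_iter A app r i s \<noteq> app_iter A app r j s))"
proof
  fix s assume s: "s \<in> A"
  show "app r s = Some s \<or>
    (\<exists>n. app_iter A app r n s = None \<and>
      (\<forall>i<n. \<forall>j<n. i \<noteq> j \<longrightarrow> app_iter A app r i s \<noteq> app_iter A app r j s))"
  proof (cases "\<exists>n. app_iter A app r n s = None")
    case True
    define n where "n = (LEAST n. app_iter A app r n s = None)"
    have none: "app_iter A app r n s = None"
      using True unfolding n_def by (rule LeastI_ex)
    have defined: "app_iter A app r m s \<noteq> None" if "m < n" for m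
      using that unfolding n_def by (rule not_less_Least)
    have "app_iter A app r i s \<noteq> app_iter A app r j s" if "i < n" "j < n" "i \<noteq> j" for i j
      using app_iter_inj_below_Least[OF none defined, of i j]
        app_iter_inj_below_Least[OF none defined, of j i] that
      by (metis linorder_neqE_nat)
    with none show ?thesis by blast
  next
    case False
    define f where "f n = the (app_iter A app r n s)" for n
    have iter: "app_iter A app r n s = Some (f n)" for n
      using False by (simp add: f_def)
    have f0: "f 0 = s" using iter[of 0] s by simp
    \<comment> \<open>Membership in \<open>A\<close> comes from the restriction in
      \<open>app_fun\<close>: the iterate at \<open>Suc n\<close> is defined only if
      \<open>f n\<close> lies in \<open>A\<close>.\<close>
    have app_f: "f n \<in> A \<and> app r (f n) = Some (f (Suc n))" for n
      using iter[of n] iter[of "Suc n"]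
      by (auto simp: app_fun_def restrict_map_def split: if_splits)
    have "f (Suc 0) = f 0"
      by (rule posetal_total_orbit_fixed[OF assms(2,3)]) (use app_f in auto)
    then show ?thesis using app_f[of 0] f0 by simp
  qed
qed

end
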